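(* Suppose (OPT) has a feasible solution, and let $(b^*,\gamma^* )$, with set of bid values $\mathcal P$ and components $(\mathcal C_c(p^* ),\mathcal C_t(p^* ))$, $p^*\in\mathcal P$, be the allocation obtained by the algorithm described in the context. For $p^*\in\mathcal P$ let $D_{p^*}(b)=\sum_{j\in\mathcal C_t(p^* )}D_j(b)$, $b\ge0$, let $I_{p^*}=\sum_{i\in\mathcal C_c(p^* )}I_i$, and let $D^{(-)}_{p^*}(p^* )=\lim_{b\uparrow p^*}D_{p^*}(b)$. Then for every $p^*\in\mathcal P$ the following is true. For each targeting group $j\in\mathcal C_t(p^* )$ and all campaigns $i\in\mathcal B_j(b^*,\gamma^* )$ let $$\gamma_{i,j}=\frac{\gamma^*_{i,j}}{\sum_{m\in\mathcal B_j(b^*,\gamma^* )}\gamma^*_{m,j}}.$$ For $0\le b_1<p^*$ let $s_{p^*}(b_1)$ be the mixed bidding strategy for the component $(\mathcal C_c(p^* ),\mathcal C_t(p^* ))$ such that for all campaigns $i\in\mathcal C_c(p^* )$ and all $j\in\mathcal A_i(b^*,\gamma^* )$ campaign $i$ uses at targeting group $j$ the bid values $\mathcal P_{i,j}=\{b_1,p^*\}$ with fractions $$\gamma_{i,j}(b_1)=\frac{\gamma_{i,j}D_j(p^* )-\gamma^*_{i,j}D_j(p^* )}{D_j(p^* )-D_j(b_1)},\qquad \gamma_{i,j}(p^* )=\gamma_{i,j}-\gamma_{i,j}(b_1).$$ Let $C_{p^*}(s_{p^*}(b_1))$ be the cost of $s_{p^*}(b_1)$ on this component. If $D^{(-)}_{p^*}(p^*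 )>0$, then $$\lim_{b_1\uparrow p^*}C_{p^*}(s_{p^*}(b_1))=I_{p^*}p^*-\int_0^{p^*}D_{p^*}(b)\,db.$$
   Context: Model: $\mathcal N=\{1,\dots,N_c\}$ is a finite set of campaigns and $\mathcal T=\{1,\dots,N_r\}$ a finite set of targeting groups. Campaign $i$ requires $I_i\ge 0$ impressions and may bid only on the targeting groups in a given set $\mathcal A_i\subseteq\mathcal T$; for $j\in\mathcal T$ put $\mathcal B_j=\{i\in\mathcal N: j\in\mathcal A_i\}$, and every $\mathcal B_j$ is nonempty. Targeting group $j$ has a supply curve $D_j:[0,\infty)\to[0,\infty)$, non-decreasing and right-continuous (not necessarily continuous). Problem (OPT): minimize $\sum_{i}\sum_{j\in\mathcal A_i}\gamma_{i,j}\big(D_j(b_{i,j})b_{i,j}-\int_0^{b_{i,j}}D_j(x)\,dx\big)$ over $b_{i,j}\ge0$, $\gamma_{i,j}\ge0$ subject to $\sum_{j\in\mathcal A_i}\gamma_{i,j}D_j(b_{i,j})\ge I_i$ for all $i\in\mathcal N$ and $\sum_{i\in\mathcal B_j}\gamma_{i,j}\le1$ for all $j\in\mathcal T$. For an allocation $(b^*,\gamma^* )$: $\mathcal A_i(b^*,\gamma^* )=\{j\in\mathcal A_i:\gamma^*_{i,j}D_j(b^*_{i,j})>0\}$ and $\mathcal B_j(b^*,\gamma^* )=\{i\in\mathcal B_j:\gamma^*_{i,j}D_j(b^*_{i,j})>0\}$. The cost on the component of a mixed strategy that uses at $(i,j)$ the bid values $b\in\mathcal P_{i,j}$ with fractions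 $\gamma_{i,j}(b)$ is $$\sum_{i\in\mathcal C_c(p^* )}\sum_{j\in\mathcal A_i(b^*,\gamma^* )}\sum_{b\in\mathcal P_{i,j}}\gamma_{i,j}(b)\Big(D_j(b)b-\int_0^bD_j(x)\,dx\Big).$$ Algorithm. For $\mathcal C_c\subseteq\mathcal N$, $\mathcal C_t\subseteq\mathcal T$: PRICE$(\mathcal C_c,\mathcal C_t)$ is the unique $p\ge0$ with $\sum_{j\in\mathcal C_t}D_j(p)\ge\sum_{i\in\mathcal C_c}I_i$ and $\sum_{j\in\mathcal C_t}D_j(b)<\sum_{i\in\mathcal C_c}I_i$ for all $0\le b<p$. ALLOC$(\mathcal C_c,\mathcal C_t,p)$ is the convex problem of minimizing $\sum_{i\in\mathcal C_c}\big(I_i-\sum_{j\in\mathcal A_i\cap\mathcal C_t}t_{i,j}D_j(p)\big)^2$ over $t_{i,j}\ge0$ ($i\in\mathcal C_c$, $j\in\mathcal A_i\cap\mathcal C_t$; $t_{i,j}=0$ otherwise) subject to $\sum_{i\in\mathcal B_j\cap\mathcal C_c}t_{i,j}\le1$ for $j\in\mathcal C_t$. The recursive procedure REC$(\mathcal C_c,\mathcal C_t)$: compute $p=$ PRICE$(\mathcal C_c,\mathcal C_t)$ and an (arbitrary) optimal solution $t^*$ of ALLOC$(\mathcal C_c,\mathcal C_t,p)$. If its optimal value is $0$, stop and output the single component $(\mathcal C_c,\mathcal C_t)$ with bid value $p$ and allocation $t=t^*$. Otherwise (SPLIT) set $\mathcal C_c^{(1)}=\{i\in\mathcal C_c: I_i\ne\sum_{j\in\mathcal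 A_i\cap\mathcal C_t}t^*_{i,j}D_j(p)\}$, $\mathcal C_t^{(1)}=\mathcal C_t\cap\bigcup_{i\in\mathcal C_c^{(1)}}\mathcal A_i$, $\mathcal C_c^{(2)}=\mathcal C_c\setminus\mathcal C_c^{(1)}$, $\mathcal C_t^{(2)}=\mathcal C_t\setminus\mathcal C_t^{(1)}$, and output all components output by REC$(\mathcal C_c^{(1)},\mathcal C_t^{(1)})$ and REC$(\mathcal C_c^{(2)},\mathcal C_t^{(2)})$. Run REC$(\mathcal N,\mathcal T)$. Let $\mathcal P$ be the set of bid values of the output components; the components are indexed by their bid values $p^*\in\mathcal P$ and written $(\mathcal C_c(p^* ),\mathcal C_t(p^* ))$. The allocation $(b^*,\gamma^* )$ obtained by the algorithm is: for $i\in\mathcal C_c(p^* )$, $b^*_{i,j}=p^*$ and $\gamma^*_{i,j}=t_{i,j}$ if $j\in\mathcal C_t(p^* )$ (with $t$ the allocation of that component), and $\gamma^*_{i,j}=0$ if $j\notin\mathcal C_t(p^* )$.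
   Formalization: Two conditions are added per component: every targeting group with positive supply at some bid below p* has a campaign with a positive allocation there, and no fraction γ_{i,j}(b_1) is a nonzero number divided by 0 (0/0 is read as 0); without the first the claim is false, without the second undefined. *)

theory Defs
  imports "HOL-Analysis.Analysis"
begin

text \<open>
  Campaigns and targeting groups are natural numbers. Throughout, \<open>I i\<close> is the number of
  impressions required by campaign \<open>i\<close>, \<open>A i\<close> is the set of targeting groups campaign \<open>i\<close> may bid
  on, and \<open>D j\<close> is the supply curve of targeting group \<open>j\<close>; only the values of \<open>D j\<close> on \<open>{0..}\<close>
  are meaningful.
\<close>

definition bidders :: "nat set \<Rightarrow> (nat \<Rightarrow> nat set) \<Rightarrow> nat \<Rightarrow> nat set" where
  "bidders N A j = {i \<in> N. j \<in> A i}"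

definition supply_curve :: "(real \<Rightarrow> real) \<Rightarrow> bool" where
  "supply_curve f \<longleftrightarrow>
     (\<forall>x\<ge>0. 0 \<le> f x) \<and> mono_on {0..} f \<and> (\<forall>x\<ge>0. continuous (at_right x) f)"

definition market ::
  "nat set \<Rightarrow> nat set \<Rightarrow> (nat \<Rightarrow> real) \<Rightarrow> (nat \<Rightarrow> nat set) \<Rightarrow> (nat \<Rightarrow> real \<Rightarrow> real) \<Rightarrow> bool" where
  "market N T I A D \<longleftrightarrow>
     (\<forall>i\<in>N. 0 \<le> I i) \<and> (\<forall>i\<in>N. A i \<subseteq> T) \<and> (\<forall>j\<in>T. bidders N A j \<noteq> {}) \<and>
     (\<forall>j\<in>T. supply_curve (D j))"

definition opt_feasible ::
  "nat set \<Rightarrow> nat set \<Rightarrow> (nat \<Rightarrow> real) \<Rightarrow> (nat \<Rightarrow> nat set) \<Rightarrow> (nat \<Rightarrow> real \<Rightarrow> real) \<Rightarrow>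
   (nat \<Rightarrow> nat \<Rightarrow> real) \<Rightarrow> (nat \<Rightarrow> nat \<Rightarrow> real) \<Rightarrow> bool" where
  "opt_feasible N T I A D b \<gamma> \<longleftrightarrow>
     (\<forall>i\<in>N. \<forall>j\<in>A i. 0 \<le> b i j \<and> 0 \<le> \<gamma> i j) \<and>
     (\<forall>i\<in>N. (\<Sum>j\<in>A i. \<gamma> i j * D j (b i j)) \<ge> I i) \<and>
     (\<forall>j\<in>T. (\<Sum>i\<in>bidders N A j. \<gamma> i j) \<le> 1)"

definition is_price ::
  "(nat \<Rightarrow> real) \<Rightarrow> (nat \<Rightarrow> real \<Rightarrow> real) \<Rightarrow> nat set \<Rightarrow> nat set \<Rightarrow> real \<Rightarrow> bool" where
  "is_price I D Cc Ct p \<longleftrightarrow>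
     0 \<le> p \<and> (\<Sum>j\<in>Ct. D j p) \<ge> (\<Sum>i\<in>Cc. I i) \<and>
     (\<forall>b. 0 \<le> b \<and> b < p \<longrightarrow> (\<Sum>j\<in>Ct. D j b) < (\<Sum>i\<in>Cc. I i))"

definition alloc_feasible ::
  "(nat \<Rightarrow> nat set) \<Rightarrow> nat set \<Rightarrow> nat set \<Rightarrow> (nat \<Rightarrow> nat \<Rightarrow> real) \<Rightarrow> bool" where
  "alloc_feasible A Cc Ct t \<longleftrightarrow>
     (\<forall>i\<in>Cc. \<forall>j\<in>A i \<inter> Ct. 0 \<le> t i j) \<and>
     (\<forall>i j. \<not> (i \<in> Cc \<and> j \<in> A i \<inter> Ct) \<longrightarrow> t i j = 0) \<and>
     (\<forall>j\<in>Ct. (\<Sum>i\<in>bidders Cc A j. t i j) \<le> 1)"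

definition alloc_objective ::
  "(nat \<Rightarrow> real) \<Rightarrow> (nat \<Rightarrow> nat set) \<Rightarrow> (nat \<Rightarrow> real \<Rightarrow> real) \<Rightarrow> nat set \<Rightarrow> nat set \<Rightarrow> real \<Rightarrow>
   (nat \<Rightarrow> nat \<Rightarrow> real) \<Rightarrow> real" where
  "alloc_objective I A D Cc Ct p t = (\<Sum>i\<in>Cc. (I i - (\<Sum>j\<in>A i \<inter> Ct. t i j * D j p))\<^sup>2)"

definition alloc_optimal ::
  "(nat \<Rightarrow> real) \<Rightarrow> (nat \<Rightarrow> nat set) \<Rightarrow> (nat \<Rightarrow> real \<Rightarrow> real) \<Rightarrow> nat set \<Rightarrow> nat set \<Rightarrow> real \<Rightarrow>
   (nat \<Rightarrow> nat \<Rightarrow> real) \<Rightarrow> bool" where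
  "alloc_optimal I A D Cc Ct p t \<longleftrightarrow>
     alloc_feasible A Cc Ct t \<and>
     (\<forall>u. alloc_feasible A Cc Ct u \<longrightarrow>
        alloc_objective I A D Cc Ct p t \<le> alloc_objective I A D Cc Ct p u)"

definition unmet ::
  "(nat \<Rightarrow> real) \<Rightarrow> (nat \<Rightarrow> nat set) \<Rightarrow> (nat \<Rightarrow> real \<Rightarrow> real) \<Rightarrow> nat set \<Rightarrow> nat set \<Rightarrow> real \<Rightarrow>
   (nat \<Rightarrow> nat \<Rightarrow> real) \<Rightarrow> nat set" where
  "unmet I A D Cc Ct p t = {i \<in> Cc. I i \<noteq> (\<Sum>j\<in>A i \<inter> Ct. t i j * D j p)}"

text \<open>
  \<open>rec I A D Cc Ct S\<close> states that \<open>S\<close> is the output of some run of the recursive procedure on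
  \<open>(Cc, Ct)\<close>: the procedure is nondeterministic, since the optimal solutions \<open>t\<close> are arbitrary.
  An output component is a tuple of its campaigns, its targeting groups, its bid value and its
  allocation.
\<close>

type_synonym component = "nat set \<times> nat set \<times> real \<times> (nat \<Rightarrow> nat \<Rightarrow> real)"

inductive rec ::
  "(nat \<Rightarrow> real) \<Rightarrow> (nat \<Rightarrow> nat set) \<Rightarrow> (nat \<Rightarrow> real \<Rightarrow> real) \<Rightarrow> nat set \<Rightarrow> nat set \<Rightarrow>
   component set \<Rightarrow> bool"
  for I A D where
  stop: "rec I A D Cc Ct {(Cc, Ct, p, t)}"
    if "is_price I D Cc Ct p" and "alloc_optimal I A D Cc Ct p t"
      and "alloc_objective I A D Cc Ct p t = 0"
| split: "rec I A D Cc Ct (S1 \<union> S2)"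
    if "is_price I D Cc Ct p" and "alloc_optimal I A D Cc Ct p t"
      and "alloc_objective I A D Cc Ct p t \<noteq> 0"
      and "Cc1 = unmet I A D Cc Ct p t" and "Ct1 = Ct \<inter> (\<Union>i\<in>Cc1. A i)"
      and "rec I A D Cc1 Ct1 S1" and "rec I A D (Cc - Cc1) (Ct - Ct1) S2"

text \<open>
  The bid \<open>b i j\<close> is left unconstrained where \<open>\<gamma> i j = 0\<close> is prescribed, as it has no effect there.
\<close>

definition obtained_allocation ::
  "(nat \<Rightarrow> nat set) \<Rightarrow> component set \<Rightarrow> (nat \<Rightarrow> nat \<Rightarrow> real) \<Rightarrow> (nat \<Rightarrow> nat \<Rightarrow> real) \<Rightarrow> bool" where
  "obtained_allocation A S b \<gamma> \<longleftrightarrow>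
     (\<forall>(Cc, Ct, p, t)\<in>S. \<forall>i\<in>Cc. \<forall>j\<in>A i.
        (j \<in> Ct \<longrightarrow> b i j = p \<and> \<gamma> i j = t i j) \<and> (j \<notin> Ct \<longrightarrow> \<gamma> i j = 0))"

definition used_groups ::
  "(nat \<Rightarrow> nat set) \<Rightarrow> (nat \<Rightarrow> real \<Rightarrow> real) \<Rightarrow> (nat \<Rightarrow> nat \<Rightarrow> real) \<Rightarrow> (nat \<Rightarrow> nat \<Rightarrow> real) \<Rightarrow>
   nat \<Rightarrow> nat set" where
  "used_groups A D b \<gamma> i = {j \<in> A i. \<gamma> i j * D j (b i j) > 0}"

definition active_bidders ::
  "nat set \<Rightarrow> (nat \<Rightarrow> nat set) \<Rightarrow> (nat \<Rightarrow> real \<Rightarrow> real) \<Rightarrow> (nat \<Rightarrow> nat \<Rightarrow> real) \<Rightarrow>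
   (nat \<Rightarrow> nat \<Rightarrow> real) \<Rightarrow> nat \<Rightarrow> nat set" where
  "active_bidders N A D b \<gamma> j = {i \<in> bidders N A j. \<gamma> i j * D j (b i j) > 0}"

definition total_supply :: "(nat \<Rightarrow> real \<Rightarrow> real) \<Rightarrow> nat set \<Rightarrow> real \<Rightarrow> real" where
  "total_supply D Ct x = (\<Sum>j\<in>Ct. D j x)"

definition normalized_share ::
  "nat set \<Rightarrow> (nat \<Rightarrow> nat set) \<Rightarrow> (nat \<Rightarrow> real \<Rightarrow> real) \<Rightarrow> (nat \<Rightarrow> nat \<Rightarrow> real) \<Rightarrow>
   (nat \<Rightarrow> nat \<Rightarrow> real) \<Rightarrow> nat \<Rightarrow> nat \<Rightarrow> real" where
  "normalized_share N A D b \<gamma> i j = \<gamma> i j / (\<Sum>m\<in>active_bidders N A D b \<gamma> j. \<gamma> m j)"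

definition lower_fraction ::
  "nat set \<Rightarrow> (nat \<Rightarrow> nat set) \<Rightarrow> (nat \<Rightarrow> real \<Rightarrow> real) \<Rightarrow> (nat \<Rightarrow> nat \<Rightarrow> real) \<Rightarrow>
   (nat \<Rightarrow> nat \<Rightarrow> real) \<Rightarrow> real \<Rightarrow> real \<Rightarrow> nat \<Rightarrow> nat \<Rightarrow> real" where
  "lower_fraction N A D b \<gamma> p b1 i j =
     (normalized_share N A D b \<gamma> i j * D j p - \<gamma> i j * D j p) / (D j p - D j b1)"

text \<open>
  A mixed strategy is given by the sets \<open>P i j\<close> of bid values and the fractions \<open>g i j x\<close> with
  which campaign \<open>i\<close> bids \<open>x \<in> P i j\<close> at targeting group \<open>j\<close>; the following are the fractions for
  \<open>P i j = {b1, p}\<close>.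
\<close>

definition mixed_fraction ::
  "nat set \<Rightarrow> (nat \<Rightarrow> nat set) \<Rightarrow> (nat \<Rightarrow> real \<Rightarrow> real) \<Rightarrow> (nat \<Rightarrow> nat \<Rightarrow> real) \<Rightarrow>
   (nat \<Rightarrow> nat \<Rightarrow> real) \<Rightarrow> real \<Rightarrow> real \<Rightarrow> nat \<Rightarrow> nat \<Rightarrow> real \<Rightarrow> real" where
  "mixed_fraction N A D b \<gamma> p b1 i j x =
     (if x = b1 then lower_fraction N A D b \<gamma> p b1 i j
      else if x = p then normalized_share N A D b \<gamma> i j - lower_fraction N A D b \<gamma> p b1 i j
      else 0)"

definition mixed_cost ::
  "(nat \<Rightarrow> real \<Rightarrow> real) \<Rightarrow> nat set \<Rightarrow> (nat \<Rightarrow> nat set) \<Rightarrow> (nat \<Rightarrow> nat \<Rightarrow> real set) \<Rightarrow>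
   (nat \<Rightarrow> nat \<Rightarrow> real \<Rightarrow> real) \<Rightarrow> real" where
  "mixed_cost D Cc U P g =
     (\<Sum>i\<in>Cc. \<Sum>j\<in>U i. \<Sum>x\<in>P i j. g i j x * (D j x * x - integral {0..x} (D j)))"

text \<open>
  The next two conditions say that \<open>{b1, p}\<close>-mixing makes sense on a component with bid value \<open>p\<close>.
  They do not follow from the construction of the allocation: if some supply curve of the component
  jumps at \<open>p\<close>, then the supply at \<open>p\<close> may exceed the demand, and an optimal allocation may leave
  idle a targeting group that has supply below \<open>p\<close>, or leave part of a locally constant supply
  unallocated.

  The first condition excludes idle targeting groups with supply below \<open>p\<close>. It cannot be dropped:
  take one campaign with \<open>I = 1\<close>, and two targeting groups, with supply \<open>1/2\<close> for all bids and with
  supply \<open>0\<close> below the bid \<open>1\<close> and \<open>10\<close> from there on. Here \<open>p = 1\<close>, the allocation \<open>(0, 1/10)\<close> is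
  optimal with value \<open>0\<close>, and the cost of the mixed strategy is \<open>1\<close> for every \<open>b1\<close>, whereas the demand times \<open>p\<close>
  minus the integral of the supply is \<open>1/2\<close>.

  The second condition says that the fraction of the bid \<open>b1\<close> is defined. A fraction \<open>0 / 0\<close> is
  admitted and read as \<open>0\<close>: it occurs for a fully allocated targeting group with locally constant
  supply, where no bid below \<open>p\<close> is needed.
\<close>

definition no_idle_supply_below ::
  "nat set \<Rightarrow> (nat \<Rightarrow> nat set) \<Rightarrow> (nat \<Rightarrow> real \<Rightarrow> real) \<Rightarrow> (nat \<Rightarrow> nat \<Rightarrow> real) \<Rightarrow>
   (nat \<Rightarrow> nat \<Rightarrow> real) \<Rightarrow> nat set \<Rightarrow> real \<Rightarrow> bool" where
  "no_idle_supply_below N A D b \<gamma> Ct p \<longleftrightarrow>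
     (\<forall>j\<in>Ct. (\<exists>x\<in>{0..<p}. D j x > 0) \<longrightarrow> active_bidders N A D b \<gamma> j \<noteq> {})"

definition fractions_defined ::
  "nat set \<Rightarrow> (nat \<Rightarrow> nat set) \<Rightarrow> (nat \<Rightarrow> real \<Rightarrow> real) \<Rightarrow> (nat \<Rightarrow> nat \<Rightarrow> real) \<Rightarrow>
   (nat \<Rightarrow> nat \<Rightarrow> real) \<Rightarrow> nat set \<Rightarrow> real \<Rightarrow> bool" where
  "fractions_defined N A D b \<gamma> Cc p \<longleftrightarrow>
     (\<forall>i\<in>Cc. \<forall>j\<in>used_groups A D b \<gamma> i. \<forall>x\<in>{0..<p}.
        D j p - D j x = 0 \<longrightarrow> normalized_share N A D b \<gamma> i j * D j p - \<gamma> i j * D j p = 0)"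

end

theory Submission
  imports Defs
begin

text \<open>
  On each targeting group \<open>j\<close> let \<open>G\<close> be the total fraction allocated there. Mixing in the bid
  \<open>b1 < p\<close> moves weight \<open>(1 - G) D(p) / (D(p) - D(b1))\<close> from \<open>p\<close> to \<open>b1\<close>, and the cost difference
  between the two bids is \<open>(D(p) - D(b1)) p\<close> up to an error of at most \<open>(D(p) - D(b1)) (p - b1)\<close>,
  by monotonicity of \<open>D\<close>. The denominator cancels, so in the limit the group costs
  \<open>D(p) p - \<integral>D - (1 - G) D(p) p = G D(p) p - \<integral>D\<close>. Summing over the groups of the component gives the
  claim, since the component meets its demands exactly.
\<close>

lemma rec_componentD:
  assumes "rec I A D Cc Ct S" "(C, T, p, t) \<in> S"
  shows "C \<subseteq> Cc" "T \<subseteq> Ct" "0 \<le> p" "alloc_feasible A C T t" "alloc_objective I A D C T p t = 0"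
proof -
  have "C \<subseteq> Cc \<and> T \<subseteq> Ct \<and> 0 \<le> p \<and> alloc_feasible A C T t \<and> alloc_objective I A D C T p t = 0"
    using assms
  proof (induction)
    case (stop Cc Ct p t)
    then show ?case by (auto simp: is_price_def alloc_optimal_def)
  next
    case (split Cc Ct p t Cc1 Ct1 S1 S2)
    have "Cc1 \<subseteq> Cc" using split by (auto simp: unmet_def)
    moreover have "Ct1 \<subseteq> Ct" using split by blast
    ultimately show ?case using split.IH split.prems by blast
  qed
  then show "C \<subseteq> Cc" "T \<subseteq> Ct" "0 \<le> p" "alloc_feasible A C T t"
    "alloc_objective I A D C T p t = 0" by auto
qed

lemma rec_covers_campaigns:
  assumes "rec I A D Cc Ct S" "i \<in> Cc"
  obtains C T p t where "(C, T, p, t) \<in> S" "i \<in> C"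
proof -
  have "\<exists>C T p t. (C, T, p, t) \<in> S \<and> i \<in> C"
    using assms by induction blast+
  then show ?thesis using that by blast
qed

text \<open>A split hands the disjoint sets \<open>Ct1\<close> and \<open>Ct - Ct1\<close> to its
  two calls, and every component stays inside the groups of its call. Hence a targeting group
  determines its component, including bid value and allocation.\<close>

lemma rec_groups_disjoint:
  assumes "rec I A D Cc Ct S" "(C, T, p, t) \<in> S" "(C', T', p', t') \<in> S" "j \<in> T" "j \<in> T'"
  shows "(C, T, p, t) = (C', T', p', t')"
  using assms
proof (induction)
  case (stop Cc Ct p t)
  then show ?case by auto
next
  case (split Cc Ct p t Cc1 Ct1 S1 S2)
  have "X \<subseteq> Ct1" if "(Y, X, q, u) \<in> S1" for X Y q u
    using rec_componentD(2)[OF split(6) that] .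
  moreover have "X \<subseteq> Ct - Ct1" if "(Y, X, q, u) \<in> S2" for X Y q u
    using rec_componentD(2)[OF split(7) that] .
  ultimately show ?case using split.IH split.prems by blast
qed

text \<open>One group in isolation, with \<open>F x\<close> the cost of a full share bidding
  \<open>x\<close>. If \<open>f\<close> is left-continuous at \<open>p\<close>, the weight
  \<open>w x\<close> may be unbounded near \<open>p\<close>, so the limit is taken for the whole
  combination and not term by term. Hypothesis \<open>def\<close> makes the numerator of
  \<open>w\<close> vanish whenever its denominator does.\<close>

lemma group_cost_tendsto:
  fixes f :: "real \<Rightarrow> real" and G p :: real
  defines "F \<equiv> \<lambda>x. f x * x - integral {0..x} f"
    and "w \<equiv> \<lambda>x. (1 - G) * f p / (f p - f x)"
  assumes mono: "mono_on {0..p} f"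
    and def: "\<And>x. 0 \<le> x \<Longrightarrow> x < p \<Longrightarrow> f x = f p \<Longrightarrow> (1 - G) * f p = 0"
  shows "((\<lambda>x. w x * F x + (1 - w x) * F p) \<longlongrightarrow> G * f p * p - integral {0..p} f)
    (at p within {0..<p})"
proof (rule LIM_zero_cancel, rule Lim_null_comparison)
  \<comment> \<open>This is the supply at \<open>p\<close> that the allocation leaves over. Where
    \<open>f x\<close> differs from \<open>f p\<close> it equals \<open>w x * (f p - f x)\<close>,
    whatever \<open>x\<close> is.\<close>
  define c where "c = (1 - G) * f p"
  have bound: "\<bar>w x * F x + (1 - w x) * F p - (G * f p * p - integral {0..p} f)\<bar>
      \<le> \<bar>c\<bar> * (p - x)" if x: "0 \<le> x" "x < p" for x
  proof -
    have int: "f integrable_on {0..p}"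
      using mono by (rule integrable_on_mono_on)
    have int': "f integrable_on {x..p}"
      using int by (rule integrable_on_subinterval) (use x in auto)
    have combine: "integral {0..p} f = integral {0..x} f + integral {x..p} f"
      using Henstock_Kurzweil_Integration.integral_combine[OF _ _ int, of x] x by simp
    have "integral {x..p} (\<lambda>_. f x) \<le> integral {x..p} f"
      by (rule integral_le) (use int' x mono in \<open>auto simp: mono_on_def\<close>)
    then have lower: "f x * (p - x) \<le> integral {x..p} f" using x by (simp add: mult.commute)
    have "integral {x..p} f \<le> integral {x..p} (\<lambda>_. f p)"
      by (rule integral_le) (use int' x mono in \<open>auto simp: mono_on_def\<close>)
    then have upper: "integral {x..p} f \<le> f p * (p - x)" using x by (simp add: mult.commute)
    define r where "r = f x * (p - x) - integral {x..p} f"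
    have diff: "F p - F x = (f p - f x) * p + r"
      unfolding F_def r_def combine by (simp add: algebra_simps)
    have r: "\<bar>r\<bar> \<le> (f p - f x) * (p - x)"
      using lower upper unfolding r_def by (simp add: algebra_simps)
    have eq: "w x * F x + (1 - w x) * F p - (G * f p * p - integral {0..p} f)
        = c * p - w x * (F p - F x)"
    proof -
      have "G * f p * p - integral {0..p} f = F p - c * p"
        by (simp add: F_def c_def algebra_simps)
      then show ?thesis by (simp add: algebra_simps)
    qed
    show ?thesis
    proof (cases "f x = f p")
      \<comment> \<open>Here \<open>w x\<close> is a division by zero, hence 0, and only the error
        \<open>c * p\<close> remains, which \<open>def\<close> removes.\<close>
      case True
      then have "c = 0" using def[OF x] by (simp add: c_def)
      with True show ?thesis unfolding eq by (simp add: w_def)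
    next
      case False
      have "f x \<le> f p" using mono x by (auto simp: mono_on_def)
      with False have pos: "0 < f p - f x" by simp
      have "c * p - w x * (F p - F x) = - (c * (r / (f p - f x)))"
        using pos unfolding diff w_def c_def[symmetric] by (simp add: field_simps)
      moreover have "\<bar>r / (f p - f x)\<bar> \<le> p - x"
        using r pos by (simp add: abs_divide pos_divide_le_eq mult.commute)
      ultimately show ?thesis
        unfolding eq by (simp add: abs_mult mult_left_mono del: abs_divide times_divide_eq_right)
    qed
  qed
  show "\<forall>\<^sub>F x in at p within {0..<p}.
      norm (w x * F x + (1 - w x) * F p - (G * f p * p - integral {0..p} f)) \<le> \<bar>c\<bar> * (p - x)"
    unfolding eventually_at_filter real_norm_def
    by (rule always_eventually) (auto intro: bound)
  show "((\<lambda>x. \<bar>c\<bar> * (p - x)) \<longlongrightarrow> 0) (at p within {0..<p})"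
    by (rule tendsto_eq_intros refl | simp)+
qed

theorem proposition8:
  fixes Nc Nr :: nat
    and I :: "nat \<Rightarrow> real"
    and A :: "nat \<Rightarrow> nat set"
    and D :: "nat \<Rightarrow> real \<Rightarrow> real"
    and S :: "component set"
    and b \<gamma> :: "nat \<Rightarrow> nat \<Rightarrow> real"
  defines "N \<equiv> {1..Nc}" and "T \<equiv> {1..Nr}"
  assumes "market N T I A D"
    and "\<exists>b' \<gamma>'. opt_feasible N T I A D b' \<gamma>'"
    and "rec I A D N T S"
    and "obtained_allocation A S b \<gamma>"
  shows "\<forall>(Cc, Ct, p, t)\<in>S.
    no_idle_supply_below N A D b \<gamma> Ct p \<longrightarrow>
    fractions_defined N A D b \<gamma> Cc p \<longrightarrow>
    Lim (at p within {0..<p}) (total_supply D Ct) > 0 \<longrightarrow>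
    ((\<lambda>b1. mixed_cost D Cc (used_groups A D b \<gamma>) (\<lambda>i j. {b1, p})
             (mixed_fraction N A D b \<gamma> p b1))
       \<longlongrightarrow> (\<Sum>i\<in>Cc. I i) * p - integral {0..p} (total_supply D Ct))
      (at p within {0..<p})"
proof -
  have main: "((\<lambda>b1. mixed_cost D Cc (used_groups A D b \<gamma>) (\<lambda>i j. {b1, p})
             (mixed_fraction N A D b \<gamma> p b1))
       \<longlongrightarrow> (\<Sum>i\<in>Cc. I i) * p - integral {0..p} (total_supply D Ct))
      (at p within {0..<p})"
    if comp: "(Cc, Ct, p, t) \<in> S"
      and idle: "no_idle_supply_below N A D b \<gamma> Ct p"
      and fdef: "fractions_defined N A D b \<gamma> Cc p"
    for Cc Ct p t
  proof -
    note c = rec_componentD[OF \<open>rec I A D N T S\<close> comp]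
    have fin: "finite Cc" "finite Ct"
      using c(1,2) finite_subset unfolding N_def T_def by blast+
    have curve: "supply_curve (D j)" if "j \<in> Ct" for j
      using \<open>market N T I A D\<close> c(2) that by (auto simp: market_def)
    have mono: "mono_on {0..p} (D j)" if "j \<in> Ct" for j
      using curve[OF that] by (auto simp: supply_curve_def mono_on_def)
    have nonneg: "0 \<le> D j x" if "j \<in> Ct" "0 \<le> x" for j x
      using curve that by (auto simp: supply_curve_def)
    have obt: "b i j = p" "\<gamma> i j = t i j" if "i \<in> Cc" "j \<in> A i" "j \<in> Ct" for i j
      using \<open>obtained_allocation A S b \<gamma>\<close> comp that by (fastforce simp: obtained_allocation_def)+
    have obt0: "\<gamma> i j = 0" if "(C, X, q, u) \<in> S" "i \<in> C" "j \<in> A i" "j \<notin> X" for i j C X q u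
      using \<open>obtained_allocation A S b \<gamma>\<close> that by (fastforce simp: obtained_allocation_def)
    \<comment> \<open>Both \<open>used_groups\<close> and \<open>active_bidders\<close> become
      slices of this one relation, so that sums over campaigns and groups can be
      interchanged.\<close>
    define R where "R = (\<lambda>i j. j \<in> A i \<and> \<gamma> i j * D j (b i j) > 0)"
    have used: "used_groups A D b \<gamma> i = {j. j \<in> Ct \<and> R i j}" if "i \<in> Cc" for i
    proof -
      have "j \<in> Ct" if "R i j" for j
        using obt0[OF comp \<open>i \<in> Cc\<close>, of j] that by (cases "j \<in> Ct") (auto simp: R_def)
      then show ?thesis by (auto simp: used_groups_def R_def)
    qed
    have active: "active_bidders N A D b \<gamma> j = {i. i \<in> Cc \<and> R i j}" if j: "j \<in> Ct" for j
    proof -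
      \<comment> \<open>Campaign \<open>i\<close> lies in some component, and a positive share at
        \<open>j\<close> forces \<open>j\<close> into the groups of that component. Disjointness
        identifies it with the present one.\<close>
      have "i \<in> Cc" if "i \<in> N" "R i j" for i
      proof -
        obtain C X q u where C: "(C, X, q, u) \<in> S" "i \<in> C"
          using rec_covers_campaigns[OF \<open>rec I A D N T S\<close> \<open>i \<in> N\<close>] .
        have "j \<in> X"
          using obt0[OF C, of j] \<open>R i j\<close> by (cases "j \<in> X") (auto simp: R_def)
        then show ?thesis
          using rec_groups_disjoint[OF \<open>rec I A D N T S\<close> comp C(1) j] C(2) by simp
      qed
      then show ?thesis
        using c(1) by (auto simp: active_bidders_def bidders_def R_def)
    qed
    define G where "G = (\<lambda>j. \<Sum>m | m \<in> Cc \<and> R m j. \<gamma> m j)"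
    have share: "normalized_share N A D b \<gamma> i j = \<gamma> i j / G j" if "j \<in> Ct" for i j
      by (simp add: normalized_share_def G_def active[OF that])
    have R_D: "b i j = p" "\<gamma> i j > 0" "D j p > 0" if "i \<in> Cc" "j \<in> Ct" "R i j" for i j
    proof -
      have "j \<in> A i" using that by (simp add: R_def)
      note o = obt[OF that(1) this that(2)]
      then show "b i j = p" by simp
      have "\<gamma> i j * D j p > 0" using that o by (simp add: R_def)
      then show "\<gamma> i j > 0" "D j p > 0"
        using nonneg[OF that(2) c(3)] by (auto simp: zero_less_mult_iff)
    qed
    have G_pos: "G j > 0" if "i \<in> Cc" "j \<in> Ct" "R i j" for i j
      unfolding G_def by (rule sum_pos) (use that fin R_D in auto)
    define F where "F = (\<lambda>j x. D j x * x - integral {0..x} (D j))"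
    define w where "w = (\<lambda>j x. (1 - G j) * D j p / (D j p - D j x))"
    define K where "K = (\<lambda>j x. \<Sum>i | i \<in> Cc \<and> R i j.
      \<gamma> i j / G j * (w j x * F j x + (1 - w j x) * F j p))"
    \<comment> \<open>The restriction \<open>x < p\<close> keeps the two bids distinct, so the sum
      over \<open>{x, p}\<close> has two terms.\<close>
    have cost: "mixed_cost D Cc (used_groups A D b \<gamma>) (\<lambda>i j. {x, p})
        (mixed_fraction N A D b \<gamma> p x) = (\<Sum>j\<in>Ct. K j x)" if "x < p" for x
    proof -
      have lower: "lower_fraction N A D b \<gamma> p x i j = \<gamma> i j / G j * w j x"
        if "i \<in> Cc" "j \<in> Ct" "R i j" for i j
      proof -
        have "\<gamma> i j / G j * D j p - \<gamma> i j * D j p = \<gamma> i j / G j * ((1 - G j) * D j p)"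
          using G_pos[OF that] by (simp add: field_simps)
        then show ?thesis
          by (simp add: lower_fraction_def share[OF that(2)] w_def)
      qed
      have "mixed_cost D Cc (used_groups A D b \<gamma>) (\<lambda>i j. {x, p}) (mixed_fraction N A D b \<gamma> p x)
        = (\<Sum>i\<in>Cc. \<Sum>j | j \<in> Ct \<and> R i j.
             \<gamma> i j / G j * (w j x * F j x + (1 - w j x) * F j p))"
        unfolding mixed_cost_def
      proof (intro sum.cong used refl)
        fix i j assume "i \<in> Cc" "j \<in> {j. j \<in> Ct \<and> R i j}"
        then show "(\<Sum>y\<in>{x, p}. mixed_fraction N A D b \<gamma> p x i j y *
              (D j y * y - integral {0..y} (D j)))
            = \<gamma> i j / G j * (w j x * F j x + (1 - w j x) * F j p)"
          using \<open>x < p\<close> by (simp add: mixed_fraction_def lower share F_def algebra_simps)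
      qed
      also have "\<dots> = (\<Sum>j\<in>Ct. K j x)"
        unfolding K_def using fin by (rule sum.swap_restrict)
      finally show ?thesis .
    qed
    have K_lim: "(K j \<longlongrightarrow> G j * D j p * p - integral {0..p} (D j)) (at p within {0..<p})"
      if j: "j \<in> Ct" for j
    proof (cases "\<exists>i\<in>Cc. R i j")
      case True
      then obtain i where i: "i \<in> Cc" "R i j" by blast
      \<comment> \<open>The mixing weight \<open>w j x\<close> is the same for all campaigns active
        at \<open>j\<close>, and their normalized shares add up to 1.\<close>
      have K: "K j x = w j x * F j x + (1 - w j x) * F j p" for x
      proof -
        have "(\<Sum>m | m \<in> Cc \<and> R m j. \<gamma> m j / G j) = 1"
          using G_pos[OF i(1) j i(2)] by (simp add: G_def flip: sum_divide_distrib)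
        then show ?thesis unfolding K_def sum_distrib_right[symmetric] by simp
      qed
      \<comment> \<open>One active campaign suffices: dividing its condition by the positive share
        \<open>\<gamma> i j / G j\<close> gives the condition on the whole group.\<close>
      have "(1 - G j) * D j p = 0" if "0 \<le> x" "x < p" "D j x = D j p" for x
      proof -
        have "\<gamma> i j / G j * D j p - \<gamma> i j * D j p = 0"
          using fdef[unfolded fractions_defined_def, rule_format, of i j x] i j that
          by (simp add: used share)
        then show ?thesis
          using G_pos[OF i(1) j i(2)] R_D[OF i(1) j i(2)] by (simp add: field_simps)
      qed
      then show ?thesis
        unfolding K w_def F_def by (intro group_cost_tendsto mono j)
    next
      \<comment> \<open>In an idle group \<open>K j\<close> and \<open>G j\<close> are empty sums,
        so the integral of \<open>D j\<close> has to vanish. It does because supply is 0 below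
        \<open>p\<close>; a jump at \<open>p\<close> affects a null set only.\<close>
      case False
      then have "active_bidders N A D b \<gamma> j = {}" using active[OF j] by auto
      then have "\<not> D j x > 0" if "x \<in> {0..<p}" for x
        using idle j that unfolding no_idle_supply_below_def by blast
      then have "D j x = 0" if "x \<in> {0..p} - {p}" for x
        using nonneg[OF j, of x] that by fastforce
      then have "integral {0..p} (D j) = integral {0..p} (\<lambda>_. 0)"
        by (intro integral_spike[of "{p}"]) auto
      moreover have none: "{i. i \<in> Cc \<and> R i j} = {}" using False by auto
      ultimately show ?thesis by (simp add: K_def G_def none)
    qed
    \<comment> \<open>The objective value 0 is a sum of squares, so each campaign meets its demand
      exactly; groups where \<open>R i j\<close> fails contribute nothing.\<close>
    have demand: "I i = (\<Sum>j | j \<in> Ct \<and> R i j. \<gamma> i j * D j p)" if i: "i \<in> Cc" for i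
    proof -
      have "I i - (\<Sum>j\<in>A i \<inter> Ct. t i j * D j p) = 0"
        using c(5) fin i by (simp add: alloc_objective_def sum_nonneg_eq_0_iff)
      moreover have "(\<Sum>j\<in>A i \<inter> Ct. t i j * D j p) = (\<Sum>j | j \<in> Ct \<and> R i j. \<gamma> i j * D j p)"
      proof (rule sum.mono_neutral_cong_right)
        show "\<forall>j\<in>A i \<inter> Ct - {j. j \<in> Ct \<and> R i j}. t i j * D j p = 0"
        proof
          fix j assume j: "j \<in> A i \<inter> Ct - {j. j \<in> Ct \<and> R i j}"
          then have "0 \<le> t i j" using c(4) i by (auto simp: alloc_feasible_def)
          then have "0 \<le> t i j * D j p" using nonneg[of j p] j c(3) by auto
          moreover have "\<not> t i j * D j p > 0" using j i obt[of i j] by (auto simp: R_def)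
          ultimately show "t i j * D j p = 0" by simp
        qed
      qed (use fin i obt in \<open>auto simp: R_def\<close>)
      ultimately show ?thesis by simp
    qed
    have "(\<Sum>i\<in>Cc. I i) = (\<Sum>i\<in>Cc. \<Sum>j | j \<in> Ct \<and> R i j. \<gamma> i j * D j p)"
      by (intro sum.cong refl demand)
    also have "\<dots> = (\<Sum>j\<in>Ct. \<Sum>i | i \<in> Cc \<and> R i j. \<gamma> i j * D j p)"
      using fin by (rule sum.swap_restrict)
    finally have total: "(\<Sum>i\<in>Cc. I i) = (\<Sum>j\<in>Ct. G j * D j p)"
      by (simp add: G_def sum_distrib_right)
    have "integral {0..p} (total_supply D Ct) = (\<Sum>j\<in>Ct. integral {0..p} (D j))"
      unfolding total_supply_def
      by (rule integral_sum) (use fin mono in \<open>auto intro: integrable_on_mono_on\<close>)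
    with total have limit: "(\<Sum>i\<in>Cc. I i) * p - integral {0..p} (total_supply D Ct)
        = (\<Sum>j\<in>Ct. G j * D j p * p - integral {0..p} (D j))"
      by (simp add: sum_distrib_right sum_subtractf)
    have "((\<lambda>x. \<Sum>j\<in>Ct. K j x) \<longlongrightarrow> (\<Sum>j\<in>Ct. G j * D j p * p - integral {0..p} (D j)))
        (at p within {0..<p})"
      by (intro tendsto_sum K_lim)
    then show ?thesis
      unfolding limit
      by (rule Lim_transform_eventually)
        (auto simp: eventually_at_filter cost intro!: always_eventually)
  qed
  then show ?thesis by blast
qed

end
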